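(* Let $\mu_1,\mu_2$ be sub-distributions over countable sets $A_1$ and $A_2$, let $f_i:A_i\to B_i$ ($i=1,2$) be functions into countable sets, let $R\subseteq B_1\times B_2$, and let $\varepsilon,\delta$ be reals. Then there is an $(\varepsilon,\delta)$-approximate lifting of the relation $\{(a_1,a_2)\in A_1\times A_2 : (f_1(a_1),f_2(a_2))\in R\}$ relating $\mu_1$ and $\mu_2$ if and only if there is an $(\varepsilon,\delta)$-approximate lifting of $R$ relating $f_1^\sharp(\mu_1)$ and $f_2^\sharp(\mu_2)$.
   Context: A sub-distribution over a countable set $A$ is a map $\mu:A\to[0,1]$ with $\sum_{a\in A}\mu(a)\le 1$; $\mu(S)=\sum_{a\in S}\mu(a)$. For $f:A\to B$, $f^\sharp(\mu)$ is the sub-distribution over $B$ with $f^\sharp(\mu)(b)=\mu(f^{-1}(b))$. For $\mu$ over $A_1\times A_2$, $\pi_1(\mu)(a_1)=\sum_{a_2}\mu(a_1,a_2)$ and $\pi_2(\mu)(a_2)=\sum_{a_1}\mu(a_1,a_2)$. For sub-distributions $\nu_1,\nu_2$ over the same set $X$, $d_\varepsilon(\nu_1,\nu_2)=\max_{S\subseteq X}(\nu_1(S)-e^{\varepsilon}\nu_2(S))$. Let $\star$ be a fresh element, $A^\star=A\cup\{\star\}$, and for $R\subseteq A_1\times A_2$ let $R^\star=R\cup(A_1\times\{\star\})\cup(\{\star\}\times A_2)$. An $(\varepsilon,\delta)$-approximate $R$-lifting of $(\mu_1,\mu_2)$ exists if there are sub-distributions $\mu_L,\mu_R$ over $A_1^\star\times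 A_2^\star$ with $\pi_1(\mu_L)=\mu_1$, $\pi_2(\mu_R)=\mu_2$ (viewing $\mu_i$ as giving mass $0$ to $\star$), $\mathrm{supp}(\mu_L)\cup\mathrm{supp}(\mu_R)\subseteq R^\star$, and $d_\varepsilon(\mu_L,\mu_R)\le\delta$. *)

theory Defs
  imports "HOL-Probability.SPMF"
begin

text \<open>
  A sub-distribution over a countable set \<open>A\<close> is an \<open>spmf\<close> whose support is contained in \<open>A\<close>;
  \<open>\<mu>(S)\<close> is \<open>measure (measure_spmf \<mu>) S\<close>, the push-forward of \<open>\<mu>\<close> along \<open>f\<close> is \<open>map_spmf f \<mu>\<close>,
  and the two projections are \<open>map_spmf fst\<close> and \<open>map_spmf snd\<close>. Carrier sets are explicit, since
  types cannot be empty.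
\<close>

text \<open>
  The distance is written as a supremum because \<open>Max\<close> is only meaningful for finite sets; by
  \<open>d_eps_is_max\<close> below it is attained, for every real \<open>\<epsilon>\<close>.
\<close>

definition d_eps :: "'a set \<Rightarrow> real \<Rightarrow> 'a spmf \<Rightarrow> 'a spmf \<Rightarrow> real" where
  "d_eps X \<epsilon> \<nu>\<^sub>1 \<nu>\<^sub>2 =
     (SUP S\<in>Pow X. measure (measure_spmf \<nu>\<^sub>1) S - exp \<epsilon> * measure (measure_spmf \<nu>\<^sub>2) S)"

text \<open>The fresh element is \<open>None\<close>, and \<open>A\<close> is embedded in its extension by \<open>Some\<close>.\<close>

definition star_set :: "'a set \<Rightarrow> 'a option set" where
  "star_set A = insert None (Some ` A)"

definition star_rel ::
  "'a set \<Rightarrow> 'b set \<Rightarrow> ('a \<times> 'b) set \<Rightarrow> ('a option \<times> 'b option) set" where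
  "star_rel A\<^sub>1 A\<^sub>2 R =
     map_prod Some Some ` R \<union> Some ` A\<^sub>1 \<times> {None} \<union> {None} \<times> Some ` A\<^sub>2"

definition approx_lifting ::
  "real \<Rightarrow> real \<Rightarrow> 'a set \<Rightarrow> 'b set \<Rightarrow> ('a \<times> 'b) set \<Rightarrow> 'a spmf \<Rightarrow> 'b spmf \<Rightarrow> bool" where
  "approx_lifting \<epsilon> \<delta> A\<^sub>1 A\<^sub>2 R \<mu>\<^sub>1 \<mu>\<^sub>2 \<longleftrightarrow>
     (\<exists>\<mu>\<^sub>L \<mu>\<^sub>R :: ('a option \<times> 'b option) spmf.
        set_spmf \<mu>\<^sub>L \<subseteq> star_set A\<^sub>1 \<times> star_set A\<^sub>2 \<and>
        set_spmf \<mu>\<^sub>R \<subseteq> star_set A\<^sub>1 \<times> star_set A\<^sub>2 \<and>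
        map_spmf fst \<mu>\<^sub>L = map_spmf Some \<mu>\<^sub>1 \<and>
        map_spmf snd \<mu>\<^sub>R = map_spmf Some \<mu>\<^sub>2 \<and>
        set_spmf \<mu>\<^sub>L \<union> set_spmf \<mu>\<^sub>R \<subseteq> star_rel A\<^sub>1 A\<^sub>2 R \<and>
        d_eps (star_set A\<^sub>1 \<times> star_set A\<^sub>2) \<epsilon> \<mu>\<^sub>L \<mu>\<^sub>R \<le> \<delta>)"

lemma measure_spmf_le_scaled:
  assumes c: "0 \<le> c" and le: "\<And>x. x \<in> S \<Longrightarrow> spmf p x \<le> c * spmf q x"
  shows "measure (measure_spmf p) S \<le> c * measure (measure_spmf q) S"
proof -
  have "emeasure (measure_spmf p) S = (\<integral>\<^sup>+ x. spmf p x \<partial>count_space S)"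
    by (simp add: nn_integral_spmf)
  also have "\<dots> \<le> (\<integral>\<^sup>+ x. ennreal c * spmf q x \<partial>count_space S)"
    using c le by (intro nn_integral_mono) (auto simp flip: ennreal_mult)
  also have "\<dots> = ennreal c * emeasure (measure_spmf q) S"
    by (simp add: nn_integral_cmult nn_integral_spmf)
  finally show ?thesis
    using c by (simp add: measure_spmf.emeasure_eq_measure flip: ennreal_mult)
qed

lemma d_eps_is_max:
  "\<exists>T\<subseteq>X. d_eps X \<epsilon> \<nu>\<^sub>1 \<nu>\<^sub>2
       = measure (measure_spmf \<nu>\<^sub>1) T - exp \<epsilon> * measure (measure_spmf \<nu>\<^sub>2) T \<and>
     (\<forall>S\<subseteq>X. measure (measure_spmf \<nu>\<^sub>1) S - exp \<epsilon> * measure (measure_spmf \<nu>\<^sub>2) S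
       \<le> measure (measure_spmf \<nu>\<^sub>1) T - exp \<epsilon> * measure (measure_spmf \<nu>\<^sub>2) T)"
proof -
  define g where
    "g S = measure (measure_spmf \<nu>\<^sub>1) S - exp \<epsilon> * measure (measure_spmf \<nu>\<^sub>2) S" for S
  define T where "T = {x\<in>X. exp \<epsilon> * spmf \<nu>\<^sub>2 x < spmf \<nu>\<^sub>1 x}"
  have TX: "T \<subseteq> X" by (auto simp: T_def)
  have split: "g A = g (A \<inter> B) + g (A - B)" for A B
  proof -
    have "measure (measure_spmf p) A
        = measure (measure_spmf p) (A \<inter> B) + measure (measure_spmf p) (A - B)" for p :: "'a spmf"
      by (subst measure_spmf.finite_measure_Union [symmetric]) (auto simp: Int_Diff_Un)
    from this[of \<nu>\<^sub>1] this[of \<nu>\<^sub>2] show ?thesis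
      by (simp add: g_def algebra_simps)
  qed
  have max: "g S \<le> g T" if "S \<subseteq> X" for S
  proof -
    have "g (S - T) \<le> 0"
      using measure_spmf_le_scaled[of "exp \<epsilon>" "S - T" \<nu>\<^sub>1 \<nu>\<^sub>2] that
      by (force simp: g_def T_def)
    moreover have "0 \<le> g (T - S)"
      using measure_spmf_le_scaled[of "exp (- \<epsilon>)" "T - S" \<nu>\<^sub>2 \<nu>\<^sub>1]
      by (force simp: g_def T_def exp_minus field_simps)
    ultimately show ?thesis
      using split[of S T] split[of T S] by (simp add: Int_commute)
  qed
  have "(SUP S\<in>Pow X. g S) = g T"
    using TX max by (intro cSup_eq_maximum) auto
  then show ?thesis
    using TX max unfolding d_eps_def g_def by blast
qed

end

theory Submission
  imports Defs
begin

text \<open>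
  Liftings can be transported along a pair of randomised maps, because applying one and the same
  Markov kernel to both witnesses does not increase \<open>d_eps\<close>. For the implication from left
  to right the kernels are \<open>f\<^sub>1\<close> and \<open>f\<^sub>2\<close>. For the converse, \<open>b\<close> is sent to a
  sample of \<open>\<mu>\<^sub>i\<close> conditioned on \<open>f\<^sub>i a = b\<close>, or to the fresh element if that event has
  probability zero. The first component of the left witness and the second component of the right
  one only take values of positive probability, so there this exception never occurs and
  conditioning restores the marginals; in the other component the fresh element is harmless.
\<close>

text \<open>Both sides are values of the sum over \<open>x\<close> of
  \<open>(spmf p x - c * spmf q x) * w x\<close> for a weight \<open>w\<close> in [0,1]. On the
  left, \<open>w x\<close> is the probability that \<open>K x\<close> lands in \<open>S\<close>; on
  the right, \<open>w\<close> is the indicator of \<open>T\<close>, which keeps exactly the positive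
  terms in full and is therefore optimal.\<close>

lemma measure_bind_spmf_diff_le:
  fixes p q :: "'a spmf" and K :: "'a \<Rightarrow> 'b spmf"
  assumes c: "0 \<le> c"
  defines "T \<equiv> {x. c * spmf q x < spmf p x}"
  shows "measure (measure_spmf (bind_spmf p K)) S - c * measure (measure_spmf (bind_spmf q K)) S
       \<le> measure (measure_spmf p) T - c * measure (measure_spmf q) T"
proof -
  let ?g = "\<lambda>x. measure (measure_spmf (K x)) S"
  have bind: "emeasure (measure_spmf (bind_spmf r K)) S
      = (\<integral>\<^sup>+ x. ennreal (spmf r x * ?g x) \<partial>count_space UNIV)" for r
    by (simp add: measure_spmf_bind o_def emeasure_bind[where N = "count_space UNIV"]
        space_measure_spmf nn_integral_measure_spmf measure_spmf.emeasure_eq_measure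
        flip: ennreal_mult)
  have ind: "emeasure (measure_spmf r) T
      = (\<integral>\<^sup>+ x. ennreal (spmf r x * indicator T x) \<partial>count_space UNIV)" for r
    by (simp add: nn_integral_count_space_indicator ennreal_mult ennreal_indicator
        flip: nn_integral_spmf)
  \<comment> \<open>The subtracted terms are moved across the inequality, so that only nonnegative
    integrals are compared and \<open>ennreal\<close> subtraction is avoided.\<close>
  have "emeasure (measure_spmf (bind_spmf p K)) S + ennreal c * emeasure (measure_spmf q) T
      = (\<integral>\<^sup>+ x. ennreal (spmf p x * ?g x + c * (spmf q x * indicator T x)) \<partial>count_space UNIV)"
    using c by (simp add: bind ind nn_integral_add ennreal_mult flip: nn_integral_cmult)
  also have "\<dots> \<le> (\<integral>\<^sup>+ x. ennreal (c * (spmf q x * ?g x) + spmf p x * indicator T x)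
      \<partial>count_space UNIV)"
  proof (intro nn_integral_mono ennreal_leI)
    fix x
    have "(spmf p x - c * spmf q x) * ?g x \<le> (spmf p x - c * spmf q x) * indicator T x"
    proof (cases "x \<in> T")
      case True
      then show ?thesis
        using measure_spmf.subprob_measure_le_1[of "K x" S]
        by (simp add: T_def mult_left_le)
    next
      case False
      then show ?thesis
        by (simp add: T_def mult_nonpos_nonneg)
    qed
    then show "spmf p x * ?g x + c * (spmf q x * indicator T x)
        \<le> c * (spmf q x * ?g x) + spmf p x * indicator T x"
      by (simp add: algebra_simps)
  qed
  also have "\<dots> = ennreal c * emeasure (measure_spmf (bind_spmf q K)) S
      + emeasure (measure_spmf p) T"
    using c by (simp add: bind ind nn_integral_add ennreal_mult flip: nn_integral_cmult)
  finally show ?thesis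
    using c by (simp add: measure_spmf.emeasure_eq_measure flip: ennreal_mult ennreal_plus)
qed

lemma d_eps_bind_spmf_le:
  assumes "set_spmf p \<subseteq> X"
  shows "d_eps Y \<epsilon> (bind_spmf p K) (bind_spmf q K) \<le> d_eps X \<epsilon> p q"
proof -
  let ?T = "{x. exp \<epsilon> * spmf q x < spmf p x}"
  \<comment> \<open>A point of \<open>?T\<close> has \<open>p\<close>-mass above a nonnegative
    number, hence positive. This puts the maximising set inside \<open>X\<close>.\<close>
  have "?T \<subseteq> set_spmf p"
    by (auto simp: in_set_spmf_iff_spmf dest: order.strict_trans1[rotated] simp flip: not_le)
  then have "?T \<subseteq> X"
    using assms by blast
  then have "measure (measure_spmf p) ?T - exp \<epsilon> * measure (measure_spmf q) ?T \<le> d_eps X \<epsilon> p q"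
    using d_eps_is_max[of X \<epsilon> p q] by auto
  moreover obtain S where
    "d_eps Y \<epsilon> (bind_spmf p K) (bind_spmf q K)
     = measure (measure_spmf (bind_spmf p K)) S - exp \<epsilon> * measure (measure_spmf (bind_spmf q K)) S"
    using d_eps_is_max[of Y \<epsilon> "bind_spmf p K" "bind_spmf q K"] by auto
  ultimately show ?thesis
    using measure_bind_spmf_diff_le[of "exp \<epsilon>" p K S q] by simp
qed

text \<open>Law of total probability over the fibres of \<open>f\<close>: the outer draw hits the
  fibre containing \<open>x\<close> with probability equal to the mass of that fibre, which cancels
  the denominator in the conditional mass of \<open>x\<close>.\<close>

lemma bind_spmf_cond_fibre: "bind_spmf \<mu> (\<lambda>a. cond_spmf \<mu> (f -` {f a})) = \<mu>"
proof (rule spmf_eqI)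
  fix x
  let ?F = "f -` {f x}"
  let ?c = "spmf \<mu> x / measure (measure_spmf \<mu>) ?F"
  have "ennreal (spmf (bind_spmf \<mu> (\<lambda>a. cond_spmf \<mu> (f -` {f a}))) x)
      = (\<integral>\<^sup>+ a. ennreal ?c * indicator ?F a \<partial>measure_spmf \<mu>)"
    unfolding ennreal_spmf_bind by (intro nn_integral_cong) (auto simp: indicator_def)
  also have "\<dots> = ennreal (?c * measure (measure_spmf \<mu>) ?F)"
    by (simp add: nn_integral_cmult measure_spmf.emeasure_eq_measure
        del: times_divide_eq_left flip: ennreal_mult)
  also have "?c * measure (measure_spmf \<mu>) ?F = spmf \<mu> x"
  proof -
    \<comment> \<open>If \<open>?F\<close> has measure zero, \<open>?c\<close> is 0 by the
      convention for division; this bound then forces \<open>spmf \<mu> x\<close> to be 0 as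
      well.\<close>
    have "spmf \<mu> x \<le> measure (measure_spmf \<mu>) ?F"
      unfolding spmf_conv_measure_spmf by (intro measure_spmf.finite_measure_mono) auto
    then show ?thesis
      using pmf_nonneg[of \<mu> "Some x"] by auto
  qed
  finally show "spmf (bind_spmf \<mu> (\<lambda>a. cond_spmf \<mu> (f -` {f a}))) x = spmf \<mu> x"
    by simp
qed

text \<open>Conditioning takes place in the underlying pmf, on an event that excludes the failure
  value \<open>None\<close>, so the result has mass 1 even if \<open>p\<close> has less.\<close>

lemma lossless_cond_spmf:
  assumes "set_spmf p \<inter> A \<noteq> {}"
  shows "lossless_spmf (cond_spmf p A)"
proof -
  have "set_pmf p \<inter> Some ` A \<noteq> {}"
    using assms by (auto simp: in_set_spmf)
  then show ?thesis
    using assms by (auto simp: lossless_iff_set_pmf_None cond_spmf_def set_cond_pmf)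
qed

text \<open>The \<open>None\<close> in \<open>return_spmf None\<close> is the fresh element, not
  failure: the kernel stays lossless at every point, so pairing it with another kernel loses no
  mass.\<close>

definition fibre_kernel :: "('a \<Rightarrow> 'c) \<Rightarrow> 'a spmf \<Rightarrow> 'c option \<Rightarrow> 'a option spmf" where
  "fibre_kernel f \<mu> y =
     (if y \<in> Some ` f ` set_spmf \<mu> then map_spmf Some (cond_spmf \<mu> (f -` {the y}))
      else return_spmf None)"

lemma lossless_fibre_kernel: "lossless_spmf (fibre_kernel f \<mu> y)"
  by (auto simp: fibre_kernel_def intro!: lossless_cond_spmf)

lemma set_fibre_kernel:
  assumes "x \<in> set_spmf (fibre_kernel f \<mu> y)"
  obtains (None) "x = None" "y \<notin> Some ` f ` set_spmf \<mu>"
    | (Some) a where "x = Some a" "a \<in> set_spmf \<mu>" "y = Some (f a)"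
  using assms by (auto simp: fibre_kernel_def split: if_splits)

lemma bind_fibre_kernel:
  "bind_spmf (map_spmf Some (map_spmf f \<mu>)) (fibre_kernel f \<mu>) = map_spmf Some \<mu>"
proof -
  have "bind_spmf (map_spmf Some (map_spmf f \<mu>)) (fibre_kernel f \<mu>)
      = bind_spmf \<mu> (\<lambda>a. map_spmf Some (cond_spmf \<mu> (f -` {f a})))"
    unfolding bind_map_spmf by (intro bind_spmf_cong) (auto simp: fibre_kernel_def)
  also have "\<dots> = map_spmf Some \<mu>"
    by (simp add: bind_spmf_cond_fibre flip: map_spmf_bind_spmf[unfolded o_def])
  finally show ?thesis .
qed

text \<open>Both witnesses are pushed through the product of the two kernels. The disjunction in
  \<open>rel\<close> records that the left witness has first components in the support of
  \<open>\<mu>\<^sub>1\<close> and the right one has second components in that of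
  \<open>\<mu>\<^sub>2\<close>; it serves to rule out a pair of two fresh elements.\<close>

lemma approx_lifting_kernel:
  assumes lift: "approx_lifting \<epsilon> \<delta> A\<^sub>1 A\<^sub>2 R \<mu>\<^sub>1 \<mu>\<^sub>2"
    and S: "S \<subseteq> B\<^sub>1 \<times> B\<^sub>2"
    and lossless: "\<And>x. lossless_spmf (K\<^sub>1 x)" "\<And>y. lossless_spmf (K\<^sub>2 y)"
    and K\<^sub>1: "bind_spmf (map_spmf Some \<mu>\<^sub>1) K\<^sub>1 = map_spmf Some \<nu>\<^sub>1"
    and K\<^sub>2: "bind_spmf (map_spmf Some \<mu>\<^sub>2) K\<^sub>2 = map_spmf Some \<nu>\<^sub>2"
    and rel: "\<And>x y u v. (x, y) \<in> star_rel A\<^sub>1 A\<^sub>2 R \<Longrightarrow>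
      x \<in> Some ` set_spmf \<mu>\<^sub>1 \<or> y \<in> Some ` set_spmf \<mu>\<^sub>2 \<Longrightarrow>
      u \<in> set_spmf (K\<^sub>1 x) \<Longrightarrow> v \<in> set_spmf (K\<^sub>2 y) \<Longrightarrow> (u, v) \<in> star_rel B\<^sub>1 B\<^sub>2 S"
  shows "approx_lifting \<epsilon> \<delta> B\<^sub>1 B\<^sub>2 S \<nu>\<^sub>1 \<nu>\<^sub>2"
proof -
  obtain p q where
        p: "set_spmf p \<subseteq> star_set A\<^sub>1 \<times> star_set A\<^sub>2" "map_spmf fst p = map_spmf Some \<mu>\<^sub>1"
    and q: "map_spmf snd q = map_spmf Some \<mu>\<^sub>2"
    and pq: "set_spmf p \<union> set_spmf q \<subseteq> star_rel A\<^sub>1 A\<^sub>2 R"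
    and d: "d_eps (star_set A\<^sub>1 \<times> star_set A\<^sub>2) \<epsilon> p q \<le> \<delta>"
    using lift unfolding approx_lifting_def by auto
  define K where "K z = pair_spmf (K\<^sub>1 (fst z)) (K\<^sub>2 (snd z))" for z
  have "fst ` set_spmf p = Some ` set_spmf \<mu>\<^sub>1"
    using arg_cong[OF p(2), of set_spmf] by simp
  then have p': "x \<in> Some ` set_spmf \<mu>\<^sub>1" if "(x, y) \<in> set_spmf p" for x y
    using that by (metis fst_conv image_eqI)
  have "snd ` set_spmf q = Some ` set_spmf \<mu>\<^sub>2"
    using arg_cong[OF q, of set_spmf] by simp
  then have q': "y \<in> Some ` set_spmf \<mu>\<^sub>2" if "(x, y) \<in> set_spmf q" for x y
    using that by (metis snd_conv image_eqI)
  have supp: "set_spmf (bind_spmf r K) \<subseteq> star_rel B\<^sub>1 B\<^sub>2 S"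
    if r: "r \<in> {p, q}" for r
  proof
    fix w
    assume "w \<in> set_spmf (bind_spmf r K)"
    then obtain x y where xy: "(x, y) \<in> set_spmf r" and "w \<in> set_spmf (K (x, y))"
      by (auto simp: set_bind_spmf)
    then have w: "fst w \<in> set_spmf (K\<^sub>1 x)" "snd w \<in> set_spmf (K\<^sub>2 y)"
      by (auto simp: K_def)
    have "x \<in> Some ` set_spmf \<mu>\<^sub>1 \<or> y \<in> Some ` set_spmf \<mu>\<^sub>2"
      using r xy p' q' by blast
    moreover have "(x, y) \<in> star_rel A\<^sub>1 A\<^sub>2 R"
      using r xy pq by blast
    ultimately have "(fst w, snd w) \<in> star_rel B\<^sub>1 B\<^sub>2 S"
      using rel w by blast
    then show "w \<in> star_rel B\<^sub>1 B\<^sub>2 S"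
      by simp
  qed
  have star: "star_rel B\<^sub>1 B\<^sub>2 S \<subseteq> star_set B\<^sub>1 \<times> star_set B\<^sub>2"
    using S by (auto simp: star_rel_def star_set_def)
  \<comment> \<open>The discarded draw from \<open>K\<^sub>2\<close> would scale the result by its
    weight, which is 1 by losslessness.\<close>
  have "map_spmf fst (bind_spmf p K) = bind_spmf (map_spmf fst p) K\<^sub>1"
    using lossless by (simp add: K_def map_spmf_bind_spmf bind_map_spmf o_def lossless_spmf_def)
  then have fst: "map_spmf fst (bind_spmf p K) = map_spmf Some \<nu>\<^sub>1"
    using p(2) K\<^sub>1 by simp
  have "map_spmf snd (bind_spmf q K) = bind_spmf (map_spmf snd q) K\<^sub>2"
    using lossless by (simp add: K_def map_spmf_bind_spmf bind_map_spmf o_def lossless_spmf_def)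
  then have snd: "map_spmf snd (bind_spmf q K) = map_spmf Some \<nu>\<^sub>2"
    using q K\<^sub>2 by simp
  have "d_eps (star_set B\<^sub>1 \<times> star_set B\<^sub>2) \<epsilon> (bind_spmf p K) (bind_spmf q K) \<le> \<delta>"
    using d_eps_bind_spmf_le[OF p(1)] d by (rule order_trans)
  with fst snd supp[of p] supp[of q] star show ?thesis
    unfolding approx_lifting_def by (intro exI[of _ "bind_spmf p K"] exI[of _ "bind_spmf q K"]) auto
qed

theorem theorem4p13:
  fixes A\<^sub>1 :: "'a set" and A\<^sub>2 :: "'b set" and B\<^sub>1 :: "'c set" and B\<^sub>2 :: "'d set"
    and \<mu>\<^sub>1 :: "'a spmf" and \<mu>\<^sub>2 :: "'b spmf"
    and f\<^sub>1 :: "'a \<Rightarrow> 'c" and f\<^sub>2 :: "'b \<Rightarrow> 'd"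
    and R :: "('c \<times> 'd) set" and \<epsilon> \<delta> :: real
  assumes "countable A\<^sub>1" and "countable A\<^sub>2" and "countable B\<^sub>1" and "countable B\<^sub>2"
    and "set_spmf \<mu>\<^sub>1 \<subseteq> A\<^sub>1" and "set_spmf \<mu>\<^sub>2 \<subseteq> A\<^sub>2"
    and "f\<^sub>1 \<in> A\<^sub>1 \<rightarrow> B\<^sub>1" and "f\<^sub>2 \<in> A\<^sub>2 \<rightarrow> B\<^sub>2"
    and "R \<subseteq> B\<^sub>1 \<times> B\<^sub>2"
  shows "approx_lifting \<epsilon> \<delta> A\<^sub>1 A\<^sub>2 {(a\<^sub>1, a\<^sub>2) \<in> A\<^sub>1 \<times> A\<^sub>2. (f\<^sub>1 a\<^sub>1, f\<^sub>2 a\<^sub>2) \<in> R} \<mu>\<^sub>1 \<mu>\<^sub>2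
     \<longleftrightarrow> approx_lifting \<epsilon> \<delta> B\<^sub>1 B\<^sub>2 R (map_spmf f\<^sub>1 \<mu>\<^sub>1) (map_spmf f\<^sub>2 \<mu>\<^sub>2)"
proof
  let ?R = "{(a\<^sub>1, a\<^sub>2) \<in> A\<^sub>1 \<times> A\<^sub>2. (f\<^sub>1 a\<^sub>1, f\<^sub>2 a\<^sub>2) \<in> R}"
  \<comment> \<open>The push-forward is a deterministic kernel that fixes the fresh element.\<close>
  have bind: "bind_spmf (map_spmf Some \<mu>) (\<lambda>x. return_spmf (map_option f x))
      = map_spmf Some (map_spmf f \<mu>)" for \<mu> :: "'e spmf" and f :: "'e \<Rightarrow> 'f"
    by (simp add: bind_map_spmf o_def map_spmf_conv_bind_spmf)
  show "approx_lifting \<epsilon> \<delta> B\<^sub>1 B\<^sub>2 R (map_spmf f\<^sub>1 \<mu>\<^sub>1) (map_spmf f\<^sub>2 \<mu>\<^sub>2)"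
    if "approx_lifting \<epsilon> \<delta> A\<^sub>1 A\<^sub>2 ?R \<mu>\<^sub>1 \<mu>\<^sub>2"
    using that assms(9) _ _ bind bind
  proof (rule approx_lifting_kernel)
    show "(u, v) \<in> star_rel B\<^sub>1 B\<^sub>2 R"
      if "(x, y) \<in> star_rel A\<^sub>1 A\<^sub>2 ?R"
        and "u \<in> set_spmf (return_spmf (map_option f\<^sub>1 x))"
        and "v \<in> set_spmf (return_spmf (map_option f\<^sub>2 y))" for x y u v
      using that assms(7,8) by (force simp: star_rel_def)
  qed simp_all
  show "approx_lifting \<epsilon> \<delta> A\<^sub>1 A\<^sub>2 ?R \<mu>\<^sub>1 \<mu>\<^sub>2"
    if "approx_lifting \<epsilon> \<delta> B\<^sub>1 B\<^sub>2 R (map_spmf f\<^sub>1 \<mu>\<^sub>1) (map_spmf f\<^sub>2 \<mu>\<^sub>2)"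
    using that _ lossless_fibre_kernel lossless_fibre_kernel bind_fibre_kernel bind_fibre_kernel
  proof (rule approx_lifting_kernel)
    show "(u, v) \<in> star_rel A\<^sub>1 A\<^sub>2 ?R"
      if "(x, y) \<in> star_rel B\<^sub>1 B\<^sub>2 R"
        and "x \<in> Some ` set_spmf (map_spmf f\<^sub>1 \<mu>\<^sub>1) \<or> y \<in> Some ` set_spmf (map_spmf f\<^sub>2 \<mu>\<^sub>2)"
        and u: "u \<in> set_spmf (fibre_kernel f\<^sub>1 \<mu>\<^sub>1 x)"
        and v: "v \<in> set_spmf (fibre_kernel f\<^sub>2 \<mu>\<^sub>2 y)" for x y u v
      using u
    proof (cases rule: set_fibre_kernel)
      \<comment> \<open>Here \<open>x\<close> is outside the image of the support, so the
        disjunction places \<open>y\<close> in the other image and \<open>v\<close> is not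
        fresh.\<close>
      case None
      with v that assms(5,6) show ?thesis
        by (cases rule: set_fibre_kernel) (auto simp: star_rel_def)
    next
      case (Some a)
      with v that assms(5,6) show ?thesis
        by (cases rule: set_fibre_kernel) (auto simp: star_rel_def)
    qed
  qed auto
qed

end
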